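(* Let $n\ge2$ and let $V=([n-1]\setminus R)\cup W$ be tight, where $R\subseteq[n-1]$, $W$ is a finite set of positive integers with $|R|=|W|$, and every element of $W$ is $>n-1$. Then every $r\in R$ with $2r>n-1$ divides some element of $W$. In particular, for $r\in[n-1]$ with $2r>n-1$ and an integer $w>n-1$, the set $([n-1]\setminus\{r\})\cup\{w\}$ can be tight only if $r\mid w$; so the Goddyn–Wong theorem recalled in the context classifies all tight single-speed modifications in the range $2r>n-1$: such a set is tight if and only if $w=mr$ for some integer $m$ and the equality condition of that theorem holds for $(n,r,m)$.
   Context: $\lVert x\rVert$ denotes the distance from the real number $x$ to the nearest integer, and $[n-1]=\{1,\dots,n-1\}$. For a set $V$ of $n-1$ distinct positive integers, $\mathrm{LR}(V)=\max_{t\in[0,1)}\min_{v\in V}\lVert vt\rVert$, and $V$ is called tight if $\mathrm{LR}(V)=\frac1n$. Goddyn–Wong theorem (known; may be assumed): for $n\ge2$, $r\in[n-1]$, $m\ge1$ and $s=n-r$, one has $\mathrm{LR}\bigl(([n-1]\setminus\{r\})\cup\{mr\}\bigr)\ge\frac1n$, with equality if and only if $n=2$, or $(n,r,m)=(3,1,4)$, or $\gcd(r,b)>1$ for every $b\in\{s,s+1,\dots,ms-1\}$. *)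

theory Defs
  imports "HOL-Analysis.Analysis"
begin

definition dist_int :: "real \<Rightarrow> real" where
  "dist_int x = \<bar>x - of_int (round x)\<bar>"

text \<open>The maximum over \<open>[0,1)\<close> is written as a supremum; it is attained for every finite
  nonempty \<open>V\<close>, see \<open>LR_attained\<close> and \<open>LR_upper\<close> below.\<close>

definition LR :: "nat set \<Rightarrow> real" where
  "LR V = (SUP t\<in>{0..<1}. Min ((\<lambda>v. dist_int (real v * t)) ` V))"

definition tight_speeds :: "nat \<Rightarrow> nat set \<Rightarrow> bool" where
  "tight_speeds n V \<longleftrightarrow>
     finite V \<and> 0 \<notin> V \<and> card V + 1 = n \<and> LR V = 1 / real n"

text \<open>The equality condition of the Goddyn--Wong theorem, with \<open>s = n - r\<close>. It is meant for
  \<open>1 \<le> r < n\<close> and \<open>m \<ge> 1\<close>, where no subtraction truncates; for \<open>m = 1\<close> the range of \<open>b\<close> is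
  empty.\<close>

definition Goddyn_Wong_equality :: "nat \<Rightarrow> nat \<Rightarrow> nat \<Rightarrow> bool" where
  "Goddyn_Wong_equality n r m \<longleftrightarrow>
     n = 2 \<or> (n, r, m) = (3, 1, 4) \<or> (\<forall>b\<in>{n - r..m * (n - r) - 1}. gcd r b > 1)"

lemma dist_int_le: "dist_int x \<le> \<bar>x - of_int k\<bar>"
  unfolding dist_int_def by (rule round_diff_minimal)

lemma dist_int_lipschitz: "dist_int x \<le> dist_int y + \<bar>x - y\<bar>"
  using dist_int_le[of x "round y"] unfolding dist_int_def by linarith

lemma continuous_on_dist_int: "continuous_on S dist_int"
proof (rule continuous_onI)
  fix x e :: real assume "e > 0"
  have "dist (dist_int y) (dist_int x) \<le> dist y x" for y
    using dist_int_lipschitz[of x y] dist_int_lipschitz[of y x]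
    unfolding dist_real_def by linarith
  then show "\<exists>d>0. \<forall>y\<in>S. dist y x < d \<longrightarrow> dist (dist_int y) (dist_int x) \<le> e"
    using \<open>e > 0\<close> by (meson less_eq_real_def order_trans)
qed

lemma continuous_on_Min_dist_int:
  assumes "finite V" "V \<noteq> {}"
  shows "continuous_on S (\<lambda>t. Min ((\<lambda>v. dist_int (real v * t)) ` V))"
  using assms
proof (induction rule: finite_ne_induct)
  case (singleton v)
  show ?case
    by (auto intro!: continuous_on_compose2[OF continuous_on_dist_int[of UNIV]] continuous_intros)
next
  case (insert v V)
  have "continuous_on S (\<lambda>t. dist_int (real v * t))"
    by (auto intro!: continuous_on_compose2[OF continuous_on_dist_int[of UNIV]] continuous_intros)
  then have "continuous_on S
      (\<lambda>t. min (dist_int (real v * t)) (Min ((\<lambda>v. dist_int (real v * t)) ` V)))"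
    using insert.IH by (intro continuous_on_min) auto
  then show ?case using insert.hyps by simp
qed

lemma Min_dist_int_maximum:
  assumes "finite V" "V \<noteq> {}"
  obtains t where "0 \<le> t" "t < 1"
    "\<And>u. 0 \<le> u \<Longrightarrow> u < 1 \<Longrightarrow>
      Min ((\<lambda>v. dist_int (real v * u)) ` V) \<le> Min ((\<lambda>v. dist_int (real v * t)) ` V)"
proof -
  let ?f = "\<lambda>t. Min ((\<lambda>v. dist_int (real v * t)) ` V)"
  obtain t where t: "t \<in> {0..1}" "\<forall>u\<in>{0..1}. ?f u \<le> ?f t"
    using continuous_attains_sup[OF compact_Icc _ continuous_on_Min_dist_int[OF assms],
      of "0::real" 1] by auto
  have "?f 1 = ?f 0" by (simp add: dist_int_def)
  then have "\<forall>u\<in>{0..1}. ?f u \<le> ?f (if t = 1 then 0 else t)" using t by auto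
  then show ?thesis using t(1) that[of "if t = 1 then 0 else t"] by auto
qed

lemma LR_upper:
  assumes "finite V" "V \<noteq> {}" "0 \<le> u" "u < 1"
  shows "Min ((\<lambda>v. dist_int (real v * u)) ` V) \<le> LR V"
proof -
  obtain t where t: "0 \<le> t" "t < 1"
    "\<And>u. 0 \<le> u \<Longrightarrow> u < 1 \<Longrightarrow>
      Min ((\<lambda>v. dist_int (real v * u)) ` V) \<le> Min ((\<lambda>v. dist_int (real v * t)) ` V)"
    using Min_dist_int_maximum[OF assms(1,2)] by blast
  show ?thesis
    unfolding LR_def
  proof (rule cSUP_upper)
    show "bdd_above ((\<lambda>t. Min ((\<lambda>v. dist_int (real v * t)) ` V)) ` {0..<1})"
      by (rule bdd_aboveI2[OF t(3)]) auto
  qed (use assms in auto)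
qed

lemma LR_attained:
  assumes "finite V" "V \<noteq> {}"
  shows "\<exists>t\<in>{0..<1}. LR V = Min ((\<lambda>v. dist_int (real v * t)) ` V)"
proof -
  obtain t where t: "0 \<le> t" "t < 1"
    "\<And>u. 0 \<le> u \<Longrightarrow> u < 1 \<Longrightarrow>
      Min ((\<lambda>v. dist_int (real v * u)) ` V) \<le> Min ((\<lambda>v. dist_int (real v * t)) ` V)"
    using Min_dist_int_maximum[OF assms] by blast
  have "LR V \<le> Min ((\<lambda>v. dist_int (real v * t)) ` V)"
    unfolding LR_def by (rule cSUP_least) (use t in auto)
  then show ?thesis using LR_upper[OF assms t(1,2)] t by force
qed

end

theory Submission
  imports Defs "HOL-Number_Theory.Cong"
begin

text \<open>At \<open>t = 1 / r\<close> every speed not divisible by \<open>r\<close> has distance at least \<open>1 / r > 1 / n\<close>, and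
  \<open>2 r > n - 1\<close> makes \<open>r\<close> its only multiple in \<open>[n - 1]\<close>; so a tight \<open>V\<close> omitting \<open>r\<close> contains
  another multiple of \<open>r\<close>.

  For the Goddyn--Wong classification in the range \<open>2 r > n - 1\<close>, put \<open>s = n - r\<close>. If
  \<open>t\<close> keeps all speeds farther than \<open>1 / n\<close> from the integers, Dirichlet's theorem forces the
  distance of \<open>r t\<close> to be at most \<open>1 / n\<close>, so up to sign \<open>t = (a + x / n) / r\<close> with \<open>0 \<le> x \<le> 1\<close>,
  and \<open>a\<close> is coprime to \<open>r\<close> because the speed \<open>r / gcd a r\<close> would be too close otherwise.
  The only binding conditions are \<open>m x > 1\<close>, from the speed \<open>m r\<close>, and \<open>b x < s\<close>, from the
  largest \<open>b \<le> n - 1\<close> with \<open>a b \<equiv> -1\<close> modulo \<open>r\<close>. Some \<open>x\<close> satisfies both iff \<open>b < m s\<close>, and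
  as \<open>a\<close> varies \<open>b\<close> runs through the integers in \<open>{s..n - 1}\<close> coprime to \<open>r\<close>.\<close>

section \<open>Distance to the nearest integer, and \<open>LR\<close> over all real times\<close>

lemma less_dist_int_iff: "c < dist_int x \<longleftrightarrow> (\<forall>k::int. c < \<bar>x - of_int k\<bar>)"
  using dist_int_le[of x] order_less_le_trans unfolding dist_int_def by blast

lemma le_dist_int_iff: "c \<le> dist_int x \<longleftrightarrow> (\<forall>k::int. c \<le> \<bar>x - of_int k\<bar>)"
  using dist_int_le[of x] order_trans unfolding dist_int_def by blast

lemma dist_int_le_half: "dist_int x \<le> 1 / 2"
  unfolding dist_int_def using of_int_round_abs_le[of x] by (simp add: abs_minus_commute)

lemma dist_int_add_int: "dist_int (x + of_int k) = dist_int x"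
proof -
  have le: "dist_int (y + of_int j) \<le> dist_int y" for y j
    using dist_int_le[of "y + of_int j" "round y + j"] unfolding dist_int_def[of y] by simp
  show ?thesis using le[of x k] le[of "x + of_int k" "- k"] by simp
qed

lemma dist_int_minus: "dist_int (- x) = dist_int x"
proof -
  have le: "dist_int (- y) \<le> dist_int y" for y
    using dist_int_le[of "- y" "- round y"] unfolding dist_int_def[of y] by simp
  show ?thesis using le[of x] le[of "- x"] by simp
qed

lemma dist_int_mult_frac: "dist_int (real v * frac t) = dist_int (real v * t)"
  using dist_int_add_int[of "real v * t" "- (int v * \<lfloor>t\<rfloor>)"]
  by (simp add: frac_def algebra_simps)

lemma dist_int_frac_le: "dist_int x \<le> frac x" "dist_int x \<le> 1 - frac x"
  using dist_int_le[of x "\<lfloor>x\<rfloor>"] dist_int_le[of x "\<lfloor>x\<rfloor> + 1"] frac_lt_1[of x] frac_ge_0[of x]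
  by (simp_all add: frac_def)

text \<open>Off the multiples of \<open>k\<close>, \<open>v - j * k\<close> is a nonzero integer for
  every \<open>j\<close>. This serves the test times 1/r, 1/n and, for n = 2, the value 1/2.\<close>

lemma le_dist_int_divide:
  assumes "k > 0" "\<not> k dvd v"
  shows "1 / real k \<le> dist_int (real v / real k)"
  unfolding le_dist_int_iff
proof
  fix j :: int
  have "int v \<noteq> j * int k" using assms by (metis dvd_triv_right int_dvd_int_iff)
  then have "1 \<le> \<bar>int v - j * int k\<bar>" by linarith
  then have "1 \<le> \<bar>real v - real_of_int j * real k\<bar>"
    by (metis (mono_tags, opaque_lifting) of_int_1_le_iff of_int_abs of_int_diff of_int_mult
        of_int_of_nat_eq)
  moreover have "real v / real k - real_of_int j = (real v - real_of_int j * real k) / real k"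
    using assms by (simp add: field_simps)
  ultimately show "1 / real k \<le> \<bar>real v / real k - real_of_int j\<bar>"
    using assms by (simp add: abs_divide divide_right_mono)
qed

text \<open>Attainment of the maximum preserves the strict inequality, and \<open>frac\<close>
  brings any real time into [0,1) without changing distances. Later arguments may therefore use
  arbitrary real times, including negative ones.\<close>

lemma less_LR_iff:
  assumes "finite V" "V \<noteq> {}"
  shows "c < LR V \<longleftrightarrow> (\<exists>t. \<forall>v\<in>V. c < dist_int (real v * t))"
proof
  show "\<exists>t. \<forall>v\<in>V. c < dist_int (real v * t)" if "c < LR V"
  proof -
    obtain t where "LR V = Min ((\<lambda>v. dist_int (real v * t)) ` V)"
      using LR_attained[OF assms] by blast
    then show ?thesis using that assms by (intro exI[of _ t]) simp
  qed
next
  assume "\<exists>t. \<forall>v\<in>V. c < dist_int (real v * t)"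
  then obtain t where t: "\<forall>v\<in>V. c < dist_int (real v * t)" by blast
  have "c < Min ((\<lambda>v. dist_int (real v * frac t)) ` V)"
    using assms t by (simp add: dist_int_mult_frac)
  also have "\<dots> \<le> LR V" using assms by (intro LR_upper) (auto simp: frac_lt_1)
  finally show "c < LR V" .
qed

lemma le_LR:
  assumes "finite V" "V \<noteq> {}" "\<And>v. v \<in> V \<Longrightarrow> c \<le> dist_int (real v * t)"
  shows "c \<le> LR V"
proof -
  have "c \<le> Min ((\<lambda>v. dist_int (real v * frac t)) ` V)"
    using assms by (simp add: dist_int_mult_frac)
  also have "\<dots> \<le> LR V" using assms by (intro LR_upper) (auto simp: frac_lt_1)
  finally show ?thesis .
qed

text \<open>The library's \<open>Dirichlet_approx\<close> only bounds the distance by \<open>1 / (n - 1)\<close>. The boxes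
  next to \<open>0\<close> and \<open>1\<close> are excluded by assumption, so \<open>n - 1\<close> multiples share \<open>n - 2\<close> boxes.\<close>

lemma Dirichlet_dist_int:
  assumes "n \<ge> 2"
  shows "\<exists>v\<in>{1..n - 1}. dist_int (real v * t) \<le> 1 / real n"
proof (rule ccontr)
  assume "\<not> ?thesis"
  then have far: "1 / real n < dist_int (real v * t)" if "v \<in> {1..n - 1}" for v
    using that by force
  define f where "f v = \<lfloor>real n * frac (real v * t)\<rfloor>" for v :: nat
  have "f v \<in> {1..int n - 2}" if "v \<in> {1..n - 1}" for v
  proof -
    have "1 / real n < frac (real v * t)" "frac (real v * t) < 1 - 1 / real n"
      using far[OF that] dist_int_frac_le[of "real v * t"] by linarith+
    then have "1 < real n * frac (real v * t)" "real n * frac (real v * t) < real n - 1"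
      using assms by (simp_all add: field_simps)
    then show ?thesis unfolding f_def by (simp add: le_floor_iff) linarith
  qed
  then have "f ` {1..n - 1} \<subseteq> {1..int n - 2}" by blast
  then have "card (f ` {1..n - 1}) \<le> card {1..int n - 2}" by (intro card_mono) auto
  also have "\<dots> < card {1..n - 1}" using assms by simp
  finally have "\<not> inj_on f {1..n - 1}" by (rule pigeonhole)
  then obtain u v where uv: "u \<in> {1..n - 1}" "v \<in> {1..n - 1}" "u < v" "f u = f v"
    by (metis (no_types, lifting) inj_onI nat_neq_iff)
  have "\<bar>real n * frac (real v * t) - real n * frac (real u * t)\<bar> < 1"
    using uv(4) unfolding f_def by linarith
  then have "\<bar>real n * (frac (real v * t) - frac (real u * t))\<bar> < 1"
    by (simp add: algebra_simps)
  then have "\<bar>frac (real v * t) - frac (real u * t)\<bar> < 1 / real n"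
    using assms by (simp add: abs_mult pos_less_divide_eq mult.commute)
  \<comment> \<open>Modulo integers, the collision in one box is a statement about the speed
    \<open>v - u\<close>, which again lies in [n-1].\<close>
  moreover have "frac (real v * t) - frac (real u * t)
      = real (v - u) * t - of_int (\<lfloor>real v * t\<rfloor> - \<lfloor>real u * t\<rfloor>)"
    using uv(3) by (simp add: frac_def of_nat_diff algebra_simps)
  moreover have "v - u \<in> {1..n - 1}" using uv by auto
  ultimately show False
    using far[of "v - u"] dist_int_le[of "real (v - u) * t" "\<lfloor>real v * t\<rfloor> - \<lfloor>real u * t\<rfloor>"]
    by simp
qed

section \<open>The divisibility condition\<close>

lemma dvd_less_double_imp_eq:
  fixes r v :: nat
  assumes "r dvd v" "0 < v" "v < 2 * r"
  shows "v = r"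
proof (rule ccontr)
  assume "v \<noteq> r"
  obtain q where q: "v = r * q" using assms(1) by blast
  then have "q \<noteq> 0" "q \<noteq> 1" using assms(2) \<open>v \<noteq> r\<close> by auto
  then have "2 * r \<le> v" using q by (simp add: mult.commute)
  then show False using assms by simp
qed

lemma tight_imp_dvd:
  assumes "R \<subseteq> {1..n - 1}" "finite W" "tight_speeds n (({1..n - 1} - R) \<union> W)"
    and r: "r \<in> R" "2 * r > n - 1"
  shows "\<exists>w\<in>W. r dvd w"
proof (rule ccontr)
  let ?V = "({1..n - 1} - R) \<union> W"
  assume none: "\<not> ?thesis"
  have r1: "1 \<le> r" "r \<le> n - 1" using assms by auto
  have "\<not> r dvd v" if "v \<in> ?V" for v
  proof
    assume "r dvd v"
    then have v: "v \<in> {1..n - 1} - R" using none that by blast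
    then show False using dvd_less_double_imp_eq[OF \<open>r dvd v\<close>] r by auto
  qed
  then have "1 / real r \<le> LR ?V"
    using r1 assms le_dist_int_divide[of r]
    by (intro le_LR[where t = "1 / real r"]) (auto simp: tight_speeds_def)
  moreover have "1 / real n < 1 / real r" using r1 by (intro divide_strict_left_mono) auto
  ultimately show False using assms by (simp add: tight_speeds_def)
qed

section \<open>Conditions on speeds modulo r\<close>

lemma less_dist_int_mult_iff:
  fixes a :: int
  assumes "r > 0" "n > 0"
  shows "1 / real n < dist_int (real v * ((of_int a + x / real n) / real r)) \<longleftrightarrow>
    (\<forall>k. real r < \<bar>real n * of_int (int v * a - k * int r) + real v * x\<bar>)"
proof -
  have "1 / real n < \<bar>real v * ((of_int a + x / real n) / real r) - of_int k\<bar> \<longleftrightarrow>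
     real r < \<bar>real n * of_int (int v * a - k * int r) + real v * x\<bar>" for k :: int
  proof -
    \<comment> \<open>Multiplying by \<open>n * r\<close> clears denominators. As \<open>k\<close>
      varies, \<open>int v * a - k * int r\<close> runs through the residue class of
      \<open>v * a\<close> modulo \<open>r\<close>.\<close>
    have "real v * ((of_int a + x / real n) / real r) - of_int k =
      (real n * of_int (int v * a - k * int r) + real v * x) / (real n * real r)"
      using assms by (simp add: field_simps)
    then show ?thesis using assms by (simp add: abs_divide abs_mult field_simps)
  qed
  then show ?thesis by (simp add: less_dist_int_iff)
qed

text \<open>The window consists of \<open>r\<close> consecutive integers, hence is a complete
  residue system modulo \<open>r\<close>.\<close>

lemma ex_cong_in_window:
  fixes c :: int
  assumes "0 < r" "r \<le> n"
  shows "\<exists>b\<in>{n - r..n - 1}. [int b = c] (mod int r)"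
proof -
  define b where "b = nat (int (n - r) + (c - int (n - r)) mod int r)"
  have mod: "0 \<le> (c - int (n - r)) mod int r" "(c - int (n - r)) mod int r < int r"
    using assms by auto
  then have b: "int b = int (n - r) + (c - int (n - r)) mod int r" unfolding b_def by simp
  have "[int b = int (n - r) + (c - int (n - r))] (mod int r)"
    unfolding b cong_def by (simp add: mod_simps)
  then have "[int b = c] (mod int r)" by simp
  moreover have "b \<in> {n - r..n - 1}"
  proof -
    have "int b \<le> int n - 1" "int n - int r \<le> int b"
      using b mod of_nat_diff[OF assms(2), where 'a = int] by linarith+
    then show ?thesis unfolding atLeastAtMost_iff by linarith
  qed
  ultimately show ?thesis by blast
qed

text \<open>Since \<open>b + r \<ge> n\<close>, a window element is the largest member of its class
  in [n-1]. It thus gives the strictest condition \<open>b * x < n - r\<close> of that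
  class.\<close>

lemma cong_in_window_le:
  fixes b v :: nat
  assumes "[int v = int b] (mod int r)" "n - r \<le> b" "v \<le> n - 1" "n > 0"
  shows "v \<le> b"
proof (rule ccontr)
  assume "\<not> v \<le> b"
  then have "0 < int v - int b" "int r dvd int v - int b"
    using assms by (auto simp: cong_iff_dvd_diff)
  then have "int r \<le> int v - int b" by (intro zdvd_imp_le)
  then show False using assms by linarith
qed

section \<open>Replacing r by m r for n at least 3\<close>

locale single_modification =
  fixes n r m :: nat
  assumes n3: "n \<ge> 3" and r_less: "r < n" and r_large: "n \<le> 2 * r" and m2: "m \<ge> 2"
begin

abbreviation V :: "nat set" where "V \<equiv> ({1..n - 1} - {r}) \<union> {m * r}"

lemma r2: "r \<ge> 2" using n3 r_large by simp

lemma V_fin: "finite V" "V \<noteq> {}" by auto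

lemma LR_gt_if_window:
  assumes b: "n - r \<le> b" "b \<le> n - 1" "b < m * (n - r)" "coprime r b"
  shows "1 / real n < LR V"
proof -
  \<comment> \<open>The numerator \<open>a\<close> is minus the inverse of \<open>b\<close>, so that
    \<open>b\<close> lies in the critical class \<open>v * a\<close> = -1 modulo
    \<open>r\<close>.\<close>
  obtain a0 :: int where "[int b * a0 = 1] (mod int r)"
    using cong_solve_coprime_int[of "int b" "int r"] b(4) by (auto simp: coprime_commute)
  then have "[- (int b * a0) = - 1] (mod int r)" by (rule cong_minus_minus_iff[THEN iffD2])
  then obtain a :: int where a: "[int b * a = - 1] (mod int r)"
    by (metis mult_minus_right)
  have cop_a: "coprime a (int r)"
  proof -
    have "coprime (int b * a) (int r)"
      using a by (metis cong_imp_coprime cong_sym coprime_1_left coprime_minus_left_iff)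
    then show ?thesis by simp
  qed
  have b0: "b > 0" using b(1) r_less by simp
  have "real b < real m * real (n - r)" using b(3) by (simp only: of_nat_less_iff flip: of_nat_mult)
  then have "1 / real m < real (n - r) / real b"
    using b0 m2 by (simp add: divide_simps mult.commute del: of_nat_diff)
  moreover have "1 / real m < 1" "1 / real m < (real n - 1) / real m"
    using m2 n3 by (simp_all add: field_simps)
  \<comment> \<open>The lower bound and \<open>(n - 1) / m\<close> keep the speed
    \<open>m * r\<close> away from the integers on both sides; \<open>(n - r) / b\<close> handles
    the class of \<open>b\<close>, and 1 gives \<open>v * x \<le> n - 1\<close> for all other
    speeds.\<close>
  ultimately have "1 / real m < min (real (n - r) / real b) (min 1 ((real n - 1) / real m))"
    by simp
  then obtain x where "1 / real m < x"
    "x < min (real (n - r) / real b) (min 1 ((real n - 1) / real m))"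
    using dense by blast
  then have x: "1 < real m * x" "real b * x < real (n - r)" "x < 1" "real m * x < real n - 1" "x > 0"
    using m2 b0 by (auto simp: field_simps intro: order_less_trans[of 0 "1 / real m"])
  let ?t = "(of_int a + x / real n) / real r"
  have "1 / real n < dist_int (real v * ?t)" if "v \<in> V" for v
  proof (cases "v = m * r")
    case True
    have "1 / real n < \<bar>real v * ?t - of_int k\<bar>" for k :: int
    proof -
      define e where "e = int m * a - k"
      have eq: "real v * ?t - of_int k = of_int e + real m * x / real n"
        using True r2 by (simp add: e_def field_simps)
      have lo: "1 / real n < real m * x / real n" and hi: "real m * x / real n < 1 - 1 / real n"
        using x n3 by (simp_all add: field_simps)
      have "0 < 1 / real n" using n3 by simp
      moreover have "e \<ge> 0 \<or> e \<le> - 1" by linarith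
      then have "(of_int e :: real) \<ge> 0 \<or> (of_int e :: real) \<le> - 1"
        by (metis of_int_0_le_iff of_int_le_iff of_int_1 of_int_minus)
      ultimately show ?thesis unfolding eq using lo hi by linarith
    qed
    then show ?thesis by (simp add: less_dist_int_iff)
  next
    case False
    then have v: "1 \<le> v" "v \<le> n - 1" "v \<noteq> r" using that by auto
    have "real r < \<bar>real n * of_int (int v * a - k * int r) + real v * x\<bar>" for k :: int
    proof -
      define e where "e = int v * a - k * int r"
      have vx: "0 \<le> real v * x" "real v * x \<le> real n - 1"
      proof -
        have "real v * x \<le> real v" using x by (simp add: mult_left_le)
        then show "real v * x \<le> real n - 1" using v n3 by linarith
      qed (use x in auto)
      have "e \<noteq> 0"
      proof
        assume "e = 0"
        then have "int r dvd int v * a" by (simp add: e_def)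
        then have "r dvd v" using cop_a by (simp add: coprime_dvd_mult_left_iff coprime_commute)
        then show False using dvd_less_double_imp_eq[of r v] v r_large n3 by linarith
      qed
      \<comment> \<open>As 0 \<le> \<open>v * x\<close> \<le> \<open>n - 1\<close>, the sum
        \<open>n * e + v * x\<close> is at least \<open>n\<close> in the first case and below
        \<open>-n\<close> in the last. Only \<open>e = - 1\<close> can come within \<open>r\<close>
        of 0.\<close>
      then consider "e \<ge> 1" | "e = - 1" | "e \<le> - 2" by linarith
      then have "real r < \<bar>real n * of_int e + real v * x\<bar>"
      proof cases
        case 1
        then have "real n * 1 \<le> real n * of_int e" by (intro mult_left_mono) auto
        then show ?thesis using vx r_less by linarith
      next
        case 2
        have "[int v * a = int b * a] (mod int r)"
        proof -
          have "int v * a - (- 1) = k * int r" using 2 by (simp add: e_def)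
          then have "[int v * a = - 1] (mod int r)" unfolding cong_iff_dvd_diff by simp
          then show ?thesis using a cong_sym cong_trans by blast
        qed
        then have "[int v = int b] (mod int r)" using cong_mult_rcancel[OF cop_a] by blast
        then have "v \<le> b" using cong_in_window_le[OF _ b(1) v(2)] n3 by simp
        then have "real v * x \<le> real b * x" using x by (intro mult_right_mono) auto
        then have "real v * x < real n - real r"
          using x(2) of_nat_diff[of r n, where 'a = real] r_less by linarith
        then show ?thesis using 2 by simp
      next
        case 3
        then have "real n * of_int e \<le> real n * (- 2)" by (intro mult_left_mono) auto
        then show ?thesis using vx r_less by linarith
      qed
      then show ?thesis by (simp add: e_def)
    qed
    then show ?thesis using r2 n3 by (subst less_dist_int_mult_iff) auto
  qed
  then show ?thesis using less_LR_iff[OF V_fin] by blast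
qed

text \<open>Coprimality depends only on the residue, so \<open>b\<close> can be moved into the
  window: a \<open>b\<close> already there stays fixed, and a \<open>b\<close> beyond
  \<open>n - 1\<close> only decreases.\<close>

lemma LR_gt_if_coprime:
  assumes b: "n - r \<le> b" "b < m * (n - r)" "coprime r b"
  shows "1 / real n < LR V"
proof -
  obtain c where c: "c \<in> {n - r..n - 1}" "[int c = int b] (mod int r)"
    using ex_cong_in_window[of r n "int b"] r2 r_less by auto
  have "coprime r c"
    using c(2) b(3) by (metis cong_imp_coprime cong_int_iff cong_sym coprime_commute)
  moreover have "c < m * (n - r)"
  proof (cases "b \<le> n - 1")
    case True
    then have "b \<le> c"
      using cong_in_window_le[OF cong_sym[OF c(2)], of n] c(1) n3 by simp
    moreover have "c \<le> b"
      using cong_in_window_le[OF c(2), of n] c(1) b(1) n3 by simp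
    ultimately show ?thesis using b by simp
  next
    case False
    then show ?thesis using b c by auto
  qed
  ultimately show ?thesis using c by (intro LR_gt_if_window) auto
qed

lemma coprime_if_LR_gt:
  assumes "1 / real n < LR V"
  shows "\<exists>b. n - r \<le> b \<and> b < m * (n - r) \<and> coprime r b"
proof -
  obtain t0 where t0: "1 / real n < dist_int (real v * t0)" if "v \<in> V" for v
    using assms less_LR_iff[OF V_fin] by blast
  obtain v where v: "v \<in> {1..n - 1}" "dist_int (real v * t0) \<le> 1 / real n"
    using Dirichlet_dist_int[of n t0] n3 by auto
  have "v = r"
  proof (rule ccontr)
    assume "v \<noteq> r"
    then have "v \<in> V" using v by simp
    then show False using t0 v by force
  qed
  then have near: "\<bar>real r * t0 - of_int (round (real r * t0))\<bar> \<le> 1 / real n"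
    using v by (simp add: dist_int_def)
  \<comment> \<open>Distances are even in the time, so the sign of \<open>t\<close> can be chosen to
    put \<open>r * t\<close> at or just to the right of an integer.\<close>
  obtain t and a :: int where t: "\<And>v. v \<in> V \<Longrightarrow> 1 / real n < dist_int (real v * t)"
    and t_near: "0 \<le> real r * t - of_int a" "real r * t - of_int a \<le> 1 / real n"
  proof (cases "0 \<le> real r * t0 - of_int (round (real r * t0))")
    case True
    then show ?thesis using that[of t0 "round (real r * t0)"] t0 near by simp
  next
    case False
    then show ?thesis
      using that[of "- t0" "- round (real r * t0)"] t0 near by (simp add: dist_int_minus)
  qed
  define x where "x = real n * (real r * t - of_int a)"
  have x: "0 \<le> x" "x \<le> 1" using t_near n3 by (simp_all add: x_def field_simps)
  have t_eq: "t = (of_int a + x / real n) / real r" using r2 n3 by (simp add: x_def field_simps)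
  have key: "real r < \<bar>real n * of_int (int v * a - k * int r) + real v * x\<bar>" if "v \<in> V" for v k
    using t[OF that] less_dist_int_mult_iff[of r n v a x] r2 n3 unfolding t_eq by auto
  have cop: "coprime a (int r)"
  proof (rule ccontr)
    assume "\<not> coprime a (int r)"
    define d where "d = nat (gcd a (int r))"
    have d_int: "int d = gcd a (int r)" by (simp add: d_def)
    then have "d > 0" "d \<noteq> 1"
      using r2 \<open>\<not> coprime a (int r)\<close> by (auto simp: coprime_iff_gcd_eq_1 intro: gr0I)
    have "int d dvd a" "int d dvd int r" by (simp_all add: d_int)
    then obtain a' r' where a': "a = int d * a'" and r': "r = d * r'" by (metis dvdE int_dvd_int_iff)
    have "r' > 0" "r' < r" using r' r2 \<open>d > 0\<close> \<open>d \<noteq> 1\<close> by (auto intro: gr0I)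
    then have "r' \<in> V" using r_less by auto
    moreover have "int r' * a - a' * int r = 0" by (simp add: a' r')
    ultimately have "real r < real r' * x" using key[of r' a'] x by simp
    moreover have "real r' * x \<le> real r'" using x by (simp add: mult_left_le)
    ultimately show False using \<open>r' < r\<close> by simp
  qed
  have mx: "1 < real m * x"
  proof -
    \<comment> \<open>The choice \<open>k = m * a\<close> cancels the multiple of \<open>n\<close>
      and leaves only \<open>m * r * x\<close>.\<close>
    have "real r < \<bar>real m * real r * x\<bar>"
      using key[of "m * r" "int m * a"] by (simp add: algebra_simps)
    then have "real r * 1 < real r * (real m * x)" using x by (simp add: algebra_simps abs_mult)
    then show ?thesis using r2 by simp
  qed
  obtain a0 :: int where a0: "[a * a0 = 1] (mod int r)"
    using cong_solve_coprime_int[OF cop] by blast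
  obtain b where b: "b \<in> {n - r..n - 1}" "[int b = - a0] (mod int r)"
    using ex_cong_in_window[of r n "- a0"] r2 r_less by auto
  have ba: "[int b * a = - 1] (mod int r)"
  proof -
    have "[int b * a = - a0 * a] (mod int r)" using b(2) by (rule cong_scalar_right)
    moreover have "[- (a * a0) = - 1] (mod int r)" using a0 by (simp only: cong_minus_minus_iff)
    ultimately show ?thesis by (metis cong_trans mult.commute mult_minus_right)
  qed
  have "coprime (int b * a) (int r)"
    using cong_imp_coprime[OF cong_sym[OF ba]] by simp
  then have cop_b: "coprime r b" by (simp add: coprime_commute)
  then have "b \<noteq> r" using r2 by auto
  then have "b \<in> V" using b r_less by auto
  obtain k where k: "int b * a - k * int r = - 1"
  proof -
    obtain k where "int b * a - (- 1) = int r * k"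
      using ba unfolding cong_iff_dvd_diff by (elim dvdE)
    then show ?thesis using that[of k] by (simp add: algebra_simps)
  qed
  have "real b * x \<le> real n - 1"
  proof -
    have "real b * x \<le> real b" using x by (simp add: mult_left_le)
    then show ?thesis using b n3 by auto
  qed
  \<comment> \<open>Here \<open>b * x < n\<close>, so the absolute value in \<open>key\<close> is
    \<open>n - b * x\<close>.\<close>
  then have "real b * x < real (n - r)"
    using key[OF \<open>b \<in> V\<close>, of k] r_less unfolding k by (simp add: of_nat_diff)
  \<comment> \<open>Eliminating \<open>x\<close> through \<open>m * x > 1\<close> yields
    \<open>b \<le> b * m * x < m * (n - r)\<close>.\<close>
  then have "real m * (real b * x) < real m * real (n - r)" using m2 by simp
  moreover have "real b * 1 \<le> real b * (real m * x)" using mx by (intro mult_left_mono) auto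
  ultimately have "real b < real m * real (n - r)" by (simp only: mult.left_commute[of "real m"])
  then have "b < m * (n - r)" by (simp only: of_nat_less_iff flip: of_nat_mult)
  then show ?thesis using b cop_b by auto
qed

text \<open>The time \<open>1 / n\<close> fails only if \<open>n\<close> divides \<open>m r\<close>. Then \<open>n\<close> divides \<open>m (n - r)\<close> too, so the
  window of \<open>LR_gt_if_coprime\<close> covers all residues modulo \<open>r\<close>.\<close>

lemma LR_ge: "1 / real n \<le> LR V"
proof (cases "n dvd m * r")
  case False
  then have "\<not> n dvd v" if "v \<in> V" for v using that n3 by (auto dest: dvd_imp_le)
  then show ?thesis
    using le_dist_int_divide[of n] n3 by (intro le_LR[OF V_fin, where t = "1 / real n"]) auto
next
  case True
  have "n dvd m * (n - r)" using True by (simp add: diff_mult_distrib2)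
  then have window: "n \<le> m * (n - r)" using m2 r_less by (intro dvd_imp_le) auto
  obtain b where b: "b \<in> {n - r..n - 1}" "[int b = 1] (mod int r)"
    using ex_cong_in_window[of r n 1] r2 r_less by auto
  have "coprime r b"
    using cong_imp_coprime[OF cong_sym[OF b(2)]] by (simp add: coprime_commute)
  moreover have "b < n" using b n3 by (simp only: atLeastAtMost_iff) linarith
  ultimately show ?thesis using b window LR_gt_if_coprime[of b] by simp
qed

lemma tight_iff:
  assumes "m * r > n - 1"
  shows "tight_speeds n V \<longleftrightarrow> Goddyn_Wong_equality n r m"
proof -
  have "card V = Suc (card ({1..n - 1} - {r}))" using assms by simp
  also have "\<dots> = n - 1" using r2 r_less by simp
  finally have "card V = n - 1" .
  then have "tight_speeds n V \<longleftrightarrow> LR V = 1 / real n"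
    using n3 r2 m2 unfolding tight_speeds_def by auto
  also have "\<dots> \<longleftrightarrow> \<not> 1 / real n < LR V" using LR_ge by auto
  also have "\<dots> \<longleftrightarrow> (\<forall>b. n - r \<le> b \<and> b < m * (n - r) \<longrightarrow> \<not> coprime r b)"
    using LR_gt_if_coprime coprime_if_LR_gt by blast
  also have "\<dots> \<longleftrightarrow> (\<forall>b\<in>{n - r..m * (n - r) - 1}. gcd r b > 1)"
  proof -
    have "gcd r b > 1 \<longleftrightarrow> \<not> coprime r b" for b
      using r2 by (auto simp: coprime_iff_gcd_eq_1 nat_neq_iff)
    \<comment> \<open>Positivity makes \<open>b \<le> m * (n - r) - 1\<close> equivalent to
      \<open>b < m * (n - r)\<close> despite truncated subtraction.\<close>
    moreover have "m * (n - r) > 0" using m2 r_less by simp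
    ultimately show ?thesis by auto
  qed
  also have "\<dots> \<longleftrightarrow> Goddyn_Wong_equality n r m"
    using n3 r2 by (auto simp: Goddyn_Wong_equality_def)
  finally show ?thesis .
qed

end

section \<open>The case n = 2 and the classification\<close>

lemma tight_singleton:
  assumes "w > 0"
  shows "tight_speeds 2 {w}"
proof -
  have "1 / 2 \<le> LR {w}"
  \<comment> \<open>At this time \<open>w\<close> sits at 1/2, the largest distance
    possible.\<close>
  proof (rule le_LR[where t = "1 / (2 * real w)"])
    show "1 / 2 \<le> dist_int (real v * (1 / (2 * real w)))" if "v \<in> {w}" for v
      using that assms le_dist_int_divide[of 2 1] by simp
  qed auto
  moreover have "LR {w} \<le> 1 / 2"
    using LR_attained[of "{w}"] dist_int_le_half by auto
  ultimately show ?thesis using assms by (simp add: tight_speeds_def)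
qed

theorem proposition1p3:
  fixes n :: nat
  assumes "n \<ge> 2"
  shows
    "(\<forall>R W :: nat set.
        R \<subseteq> {1..n - 1} \<longrightarrow> finite W \<longrightarrow> card R = card W \<longrightarrow>
        (\<forall>w\<in>W. 0 < w \<and> n - 1 < w) \<longrightarrow>
        tight_speeds n (({1..n - 1} - R) \<union> W) \<longrightarrow>
        (\<forall>r\<in>R. 2 * r > n - 1 \<longrightarrow> (\<exists>w\<in>W. r dvd w))) \<and>
     (\<forall>r\<in>{1..n - 1}. \<forall>w::nat. 2 * r > n - 1 \<longrightarrow> w > n - 1 \<longrightarrow>
        (tight_speeds n (({1..n - 1} - {r}) \<union> {w}) \<longrightarrow> r dvd w) \<and>
        (tight_speeds n (({1..n - 1} - {r}) \<union> {w}) \<longleftrightarrow>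
           (\<exists>m. w = m * r \<and> Goddyn_Wong_equality n r m)))"
proof (intro conjI allI ballI impI)
  fix R W :: "nat set" and r
  assume "R \<subseteq> {1..n - 1}" "finite W" "tight_speeds n (({1..n - 1} - R) \<union> W)"
    "r \<in> R" "2 * r > n - 1"
  then show "\<exists>w\<in>W. r dvd w" by (rule tight_imp_dvd)
next
  fix r w assume r: "r \<in> {1..n - 1}" "2 * r > n - 1" and w: "w > n - 1"
  show dvd: "r dvd w" if "tight_speeds n (({1..n - 1} - {r}) \<union> {w})"
    using tight_imp_dvd[of "{r}" n "{w}" r] that r by auto
  have iff: "tight_speeds n (({1..n - 1} - {r}) \<union> {m * r}) \<longleftrightarrow> Goddyn_Wong_equality n r m"
    if m: "w = m * r" for m
  proof (cases "n = 2")
    case True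
    then have "({1..n - 1} - {r}) \<union> {m * r} = {w}" using r m by auto
    then show ?thesis
      using True tight_singleton[of w] w by (simp only: Goddyn_Wong_equality_def) simp
  next
    case False
    \<comment> \<open>Both values would give \<open>m * r \<le> n - 1\<close>, against
      \<open>w > n - 1\<close>.\<close>
    have "m \<noteq> 0" "m \<noteq> 1" using m w r by (auto intro!: gr0I)
    then interpret single_modification n r m
      using False assms r by unfold_locales auto
    show ?thesis using tight_iff w m by simp
  qed
  show "tight_speeds n (({1..n - 1} - {r}) \<union> {w}) \<longleftrightarrow>
      (\<exists>m. w = m * r \<and> Goddyn_Wong_equality n r m)"
  proof (cases "r dvd w")
    case True
    then obtain q where q: "w = q * r" by (metis dvdE mult.commute)
    moreover have "m = q" if "w = m * r" for m using that q r by simp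
    ultimately show ?thesis using iff[OF q] by blast
  next
    case False
    then show ?thesis using dvd by auto
  qed
qed

end
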